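(* Let $\mathcal{A}$ be an arrangement of $x$-monotone pseudosegments in the plane. Then for every pair of points $a,b$ in the plane with distinct $x$-coordinates that do not lie on a common pseudosegment of $\mathcal{A}$, there exists an $x$-monotone simple curve with endpoints $a$ and $b$ that intersects every curve of $\mathcal{A}$ at most once. (That is, every arrangement of monotone pseudosegments in the plane is extendable.)
   Context: A simple curve is a subset of the plane homeomorphic to a closed interval. An arrangement of pseudosegments is a finite set of simple curves in the plane such that every pair of the curves intersects at most once, and every intersection point is a proper crossing or a common endpoint. A simple curve is $x$-monotone if it intersects every line parallel to the $y$-axis at most once. An arrangement $\mathcal{A}$ of $x$-monotone pseudosegments is called $(a,b)$-extendable (for points $a,b$ with distinct $x$-coordinates not on the same pseudosegment) if there is an $x$-monotone curve with endpoints $a,b$ intersecting every curve of $\mathcal{A}$ at most once, and extendable if it is $(a,b)$-extendable for all such choices of $a,b$. *)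

theory Defs
  imports "HOL-Analysis.Analysis"
begin

type_synonym plane = "real \<times> real"

definition simple_curve :: "plane set \<Rightarrow> bool" where
  "simple_curve C \<longleftrightarrow> C homeomorphic {0..1::real}"

definition has_endpoints :: "plane set \<Rightarrow> plane \<Rightarrow> plane \<Rightarrow> bool" where
  "has_endpoints C a b \<longleftrightarrow> (\<exists>f g. homeomorphism {0..1::real} C f g \<and> f 0 = a \<and> f 1 = b)"

definition endpoint_of :: "plane \<Rightarrow> plane set \<Rightarrow> bool" where
  "endpoint_of p C \<longleftrightarrow> (\<exists>q. has_endpoints C p q \<or> has_endpoints C q p)"

definition meets_at_most_once :: "plane set \<Rightarrow> plane set \<Rightarrow> bool" where
  "meets_at_most_once C D \<longleftrightarrow> (\<forall>p \<in> C \<inter> D. \<forall>q \<in> C \<inter> D. p = q)"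

definition x_monotone :: "plane set \<Rightarrow> bool" where
  "x_monotone C \<longleftrightarrow> (\<forall>t. meets_at_most_once C ({t} \<times> UNIV))"

text \<open>Topological transversality: near the point, the pair of curves looks like the pair of
  coordinate axes. In particular the point is an endpoint of neither curve, and the curves do not
  merely touch there.\<close>

definition proper_crossing :: "plane set \<Rightarrow> plane set \<Rightarrow> plane \<Rightarrow> bool" where
  "proper_crossing C D p \<longleftrightarrow>
     (\<exists>U h k. open U \<and> p \<in> U \<and> homeomorphism U (UNIV :: plane set) h k \<and> h p = (0, 0) \<and>
        h ` (C \<inter> U) = {z. snd z = 0} \<and> h ` (D \<inter> U) = {z. fst z = 0})"

definition pseudosegment_arrangement :: "plane set set \<Rightarrow> bool" where
  "pseudosegment_arrangement \<A> \<longleftrightarrow>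
     finite \<A> \<and> (\<forall>C \<in> \<A>. simple_curve C) \<and>
     (\<forall>C \<in> \<A>. \<forall>D \<in> \<A>. C \<noteq> D \<longrightarrow>
        meets_at_most_once C D \<and>
        (\<forall>p \<in> C \<inter> D. proper_crossing C D p \<or> endpoint_of p C \<and> endpoint_of p D))"

end

theory Submission
  imports Defs
begin

text \<open>
  The curves of \<open>\<A>\<close> are graphs of continuous functions. Start with any \<open>x\<close>-monotone path from \<open>a\<close> to \<open>b\<close>.
  Whenever the path crosses some curve \<open>C\<close> upwards and later downwards, push it down so that it runs
  just below \<open>C\<close> in between; this terminates with a path that never goes up and then down through the
  same curve. Now push up analogously as long as the path goes down and then up through some \<open>C\<close>. Since
  any two curves cross at most once, pushing up never recreates an up-down pair, so the final path
  meets every curve at most once. Curves through \<open>a\<close> or \<open>b\<close> count as lying on both sides of the path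
  there. To make this finite, the path is recorded by its heights at the abscissas of all curve ends
  and crossings; between two consecutive abscissas the curves are disjoint, and a path with
  prescribed end heights can be drawn that crosses only the curves separating them, each once.
\<close>

section \<open>Monotone curves as graphs\<close>

text \<open>Monotonicity makes \<open>fst\<close> injective on the compact set \<open>C\<close>, so
  \<open>fst\<close> is a homeomorphism from \<open>C\<close> onto a compact interval;
  \<open>f\<close> is the second coordinate of its inverse.\<close>

lemma x_monotone_curve_is_graph:
  assumes "simple_curve C" "x_monotone C"
  shows "\<exists>l r f. continuous_on {l..r} f \<and> C = (\<lambda>x. (x, f x)) ` {l..r}"
proof -
  have C: "compact C" "connected C"
    using assms(1) homeomorphic_compactness[of C "{0..1::real}"]
      homeomorphic_connectedness[of C "{0..1::real}"] by (auto simp: simple_curve_def)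
  have inj: "inj_on fst C"
  proof (rule inj_onI)
    fix p q assume "p \<in> C" "q \<in> C" "fst p = fst q"
    moreover have "meets_at_most_once C ({fst p} \<times> UNIV)" using assms(2) by (simp add: x_monotone_def)
    ultimately show "p = q" unfolding meets_at_most_once_def by (simp add: mem_Times_iff)
  qed
  have cont: "continuous_on C fst" by (intro continuous_intros)
  obtain l r where lr: "fst ` C = {l..r}"
    using C cont connected_compact_interval_1[of "fst ` C"]
      compact_continuous_image[OF cont] connected_continuous_image[OF cont] by auto
  obtain k where k: "homeomorphism C {l..r} fst k"
    using homeomorphism_compact[OF C(1) cont lr inj] by auto
  have "continuous_on {l..r} (\<lambda>x. snd (k x))"
    using k by (intro continuous_intros) (auto simp: homeomorphism_def)
  moreover have "C = (\<lambda>x. (x, snd (k x))) ` {l..r}"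
  proof -
    have "k x = (x, snd (k x))" if "x \<in> {l..r}" for x
      using k that by (metis homeomorphism_apply2 prod.collapse)
    then have "(\<lambda>x. (x, snd (k x))) ` {l..r} = k ` {l..r}" by force
    then show ?thesis using k by (auto simp: homeomorphism_def)
  qed
  ultimately show ?thesis by blast
qed

section \<open>Endpoints of curves and graphs\<close>

lemma has_endpoints_sym:
  assumes "has_endpoints C p q" shows "has_endpoints C q p"
proof -
  obtain f g where fg: "homeomorphism {0..1::real} C f g" "f 0 = p" "f 1 = q"
    using assms unfolding has_endpoints_def by blast
  have "homeomorphism {0..1::real} {0..1} (\<lambda>u. 1 - u) (\<lambda>u. 1 - u)"
    by (auto simp: homeomorphism_def image_iff intro!: continuous_intros bexI[of _ "1 - _"])
  from homeomorphism_compose[OF this fg(1)] show ?thesis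
    using fg(2,3) unfolding has_endpoints_def
    by (intro exI[of _ "f \<circ> (\<lambda>u. 1 - u)"] exI[of _ "(\<lambda>u. 1 - u) \<circ> g"]) simp
qed

lemma has_endpoints_graph:
  assumes "a < b" "continuous_on {a..b} \<gamma>"
  shows "has_endpoints ((\<lambda>x. (x, \<gamma> x)) ` {a..b}) (a, \<gamma> a) (b, \<gamma> b)"
proof -
  let ?s = "\<lambda>u. a + u * (b - a)"
  let ?f = "\<lambda>u. (?s u, \<gamma> (?s u))" and ?g = "\<lambda>p. (fst p - a) / (b - a)"
  have im: "?s ` {0..1} = {a..b}"
  proof
    show "?s ` {0..1} \<subseteq> {a..b}"
      using assms(1) mult_left_le_one_le[of "b - a"] by (fastforce simp: le_diff_eq add.commute)
    show "{a..b} \<subseteq> ?s ` {0..1}"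
    proof
      fix x assume "x \<in> {a..b}"
      then show "x \<in> ?s ` {0..1}"
        using assms(1) by (intro image_eqI[of _ _ "(x - a) / (b - a)"]) auto
    qed
  qed
  have "homeomorphism {0..1} ((\<lambda>x. (x, \<gamma> x)) ` {a..b}) ?f ?g"
  proof (rule homeomorphismI)
    have "continuous_on {0..1} (\<lambda>u. \<gamma> (?s u))"
      by (rule continuous_on_compose2[OF assms(2)]) (use im in \<open>auto intro!: continuous_intros\<close>)
    then show "continuous_on {0..1} ?f" by (intro continuous_intros)
    show "continuous_on ((\<lambda>x. (x, \<gamma> x)) ` {a..b}) ?g"
      using assms(1) by (intro continuous_intros) auto
    show "?f ` {0..1} \<subseteq> (\<lambda>x. (x, \<gamma> x)) ` {a..b}" using im by force
    show "?g ` (\<lambda>x. (x, \<gamma> x)) ` {a..b} \<subseteq> {0..1}" using assms(1) by auto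
  qed (use assms(1) in auto)
  then show ?thesis
    unfolding has_endpoints_def by (intro exI[of _ ?f] exI[of _ ?g]) auto
qed

lemma simple_curve_if_has_endpoints: "has_endpoints C p q \<Longrightarrow> simple_curve C"
  unfolding has_endpoints_def simple_curve_def homeomorphic_def using homeomorphism_sym by blast

text \<open>A parametrisation of the graph followed by \<open>fst\<close> is a continuous injection
  of the unit interval onto \<open>{l..r}\<close>, hence monotone, so its initial value is an
  extreme one. Consequently a common point in the interior of both domains cannot be excused as a
  common endpoint.\<close>

lemma endpoint_of_graph:
  assumes C: "C = (\<lambda>x. (x, f x)) ` {l..r}" and p: "endpoint_of p C"
  shows "fst p = l \<or> fst p = r"
proof (rule ccontr)
  assume ne: "\<not> (fst p = l \<or> fst p = r)"
  obtain q where "has_endpoints C p q" using p has_endpoints_sym unfolding endpoint_of_def by blast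
  then obtain h k where hk: "homeomorphism {0..1::real} C h k" "h 0 = p"
    unfolding has_endpoints_def by blast
  define z where "z u = fst (h u)" for u
  have h01: "h ` {0..1} = C" using hk(1) by (auto simp: homeomorphism_def)
  then have "p \<in> C" using hk(2) by force
  then have lpr: "l < fst p" "fst p < r" using ne C by auto
  have fstC: "fst ` C = {l..r}" using C by force
  have z01: "z ` {0..1} = {l..r}" unfolding fstC[symmetric] h01[symmetric] by (auto simp: z_def)
  have cont: "continuous_on {0..1} z"
    unfolding z_def using hk(1) by (intro continuous_intros) (auto simp: homeomorphism_def)
  have inj: "inj_on z {0..1}"
  proof (rule inj_onI)
    fix u v assume uv: "u \<in> {0..1}" "v \<in> {0..1}" "z u = z v"
    then have "h u \<in> C" "h v \<in> C" using h01 by auto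
    then have "h u = h v" using uv C by (auto simp: z_def)
    then show "u = v" using hk(1) uv by (metis homeomorphism_apply1)
  qed
  have "l \<in> z ` {0..1}" "r \<in> z ` {0..1}" using z01 lpr by auto
  then obtain u v where uv: "u \<in> {0..1}" "z u = l" "v \<in> {0..1}" "z v = r" by auto
  have z0: "z 0 = fst p" by (simp add: z_def hk(2))
  \<comment> \<open>Strict monotonicity from 0 on: all later values lie on one side of
    \<open>z 0\<close>. This contradicts reaching both \<open>l\<close> and \<open>r\<close> at
    positive parameters \<open>u\<close> and \<open>v\<close>.\<close>
  have mono: "z 0 < z x \<and> z x < z y \<or> z y < z x \<and> z x < z 0" if "0 < x" "x < y" "y \<le> 1" for x y
    using that continuous_inj_imp_mono[of 0 x y z] continuous_on_subset[OF cont, of "{0..y}"]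
      inj_on_subset[OF inj, of "{0..y}"] by auto
  have "0 < u" "0 < v" using uv z0 lpr by (cases "u = 0"; cases "v = 0"; force)+
  moreover have "u \<noteq> v" using uv lpr by auto
  ultimately show False
    using mono[of u v] mono[of v u] uv z0 lpr by (cases u v rule: linorder_cases) auto
qed

text \<open>The region between \<open>C\<close> and a horizontal line just above the touching point is connected, avoids
  \<open>C\<close> and contains both branches of \<open>D\<close>; its image under the chart of a proper crossing would avoid
  one axis and meet both halves of the other.\<close>

lemma not_proper_crossing_if_touching:
  assumes C: "C = (\<lambda>x. (x, f x)) ` {l..r}" and D: "D = (\<lambda>x. (x, f' x)) ` {l'..r'}"
    and cont: "continuous_on {l..r} f"
    and dom: "l < x0" "x0 < r"
    and touch: "f x0 = f' x0"
    and less: "\<And>x. \<lbrakk>i < x; x < k; x \<noteq> x0\<rbrakk> \<Longrightarrow> f x < f' x" and ik: "i < x0" "x0 < k"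
  shows "\<not> proper_crossing C D (x0, f x0)"
proof
  assume "proper_crossing C D (x0, f x0)"
  then obtain U and h h' :: "plane \<Rightarrow> plane" where U: "open U" "(x0, f x0) \<in> U" and h: "homeomorphism U UNIV h h'"
    and h0: "h (x0, f x0) = (0, 0)" and hC: "h ` (C \<inter> U) = {z. snd z = 0}"
    and hD: "h ` (D \<inter> U) = {z. fst z = 0}"
    unfolding proper_crossing_def by blast
  obtain d where d: "0 < d" "ball x0 d \<times> ball (f x0) d \<subseteq> U"
  proof -
    obtain V W where "open V" "open W" "x0 \<in> V" "f x0 \<in> W" "V \<times> W \<subseteq> U"
      using open_prod_elim[OF U] by (metis mem_Sigma_iff)
    moreover from this obtain e1 e2 where "0 < e1" "ball x0 e1 \<subseteq> V" "0 < e2" "ball (f x0) e2 \<subseteq> W"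
      by (meson openE)
    ultimately have "ball x0 (min e1 e2) \<times> ball (f x0) (min e1 e2) \<subseteq> U" "0 < min e1 e2"
      by (fastforce simp: subset_iff)+
    then show thesis using that by blast
  qed
  have "isCont f x0" using cont dom by (intro continuous_on_interior[of "{l..r}"]) auto
  then obtain e0 where e0: "0 < e0" "\<And>x. dist x x0 < e0 \<Longrightarrow> dist (f x) (f x0) < d"
    using d(1) unfolding continuous_at_eps_delta by (auto simp: dist_commute)
  \<comment> \<open>Within distance \<open>e\<close> of \<open>x0\<close> the graph of
    \<open>f\<close> stays inside the box contained in \<open>U\<close>, both branches of
    \<open>C\<close> exist, and \<open>less\<close> applies.\<close>
  define e where "e = Min {e0, d, x0 - l, r - x0, x0 - i, k - x0}"
  have e: "0 < e" "e \<le> e0" "e \<le> d" "e \<le> x0 - l" "e \<le> r - x0" "e \<le> x0 - i" "e \<le> k - x0"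
    using e0(1) d(1) dom ik by (auto simp: e_def)
  have near: "dist (f x) (f x0) < d \<and> l < x \<and> x < r \<and> i < x \<and> x < k \<and> dist x x0 < d"
    if "dist x x0 < e" for x
    using that e e0(2)[of x] by (auto simp: dist_real_def abs_less_iff)
  \<comment> \<open>\<open>\<Phi>\<close> stretches each vertical unit segment to the segment from
    the graph of \<open>f\<close> up to height \<open>f x0 + d\<close>. The region \<open>R\<close>
    is thus a continuous image of a convex set, hence connected.\<close>
  define \<Phi> where "\<Phi> p = (fst p, f (fst p) + snd p * (f x0 + d - f (fst p)))" for p :: "real \<times> real"
  define R where "R = \<Phi> ` (ball x0 e \<times> {0<..<1})"
  have "continuous_on (ball x0 e \<times> {0<..<1}) (\<lambda>p. f (fst p))"
    by (rule continuous_on_compose2[OF cont])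
      (use near in \<open>force intro!: continuous_intros simp: dist_commute\<close>)+
  then have "continuous_on (ball x0 e \<times> {0<..<1}) \<Phi>"
    unfolding \<Phi>_def by (intro continuous_intros)
  then have connR: "connected R"
    unfolding R_def by (intro connected_continuous_image convex_connected convex_Times) auto
  have R: "(x, y) \<in> R" if "dist x x0 < e" "f x < y" "y < f x0 + d" for x y
  proof -
    have "f x < f x0 + d" using that by linarith
    then have "\<Phi> (x, (y - f x) / (f x0 + d - f x)) = (x, y)"
      by (simp add: \<Phi>_def)
    moreover have "(x, (y - f x) / (f x0 + d - f x)) \<in> ball x0 e \<times> {0<..<1}"
      using that by (auto simp: dist_commute)
    ultimately show ?thesis unfolding R_def by (metis imageI)
  qed
  have Rd: "dist x x0 < e \<and> f x < y \<and> y < f x0 + d" if xy: "(x, y) \<in> R" for x y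
  proof -
    obtain w where w: "dist x x0 < e" "0 < w" "w < 1" "y = f x + w * (f x0 + d - f x)"
      using xy by (auto simp: R_def \<Phi>_def dist_commute)
    have "0 < f x0 + d - f x" using near[OF w(1)] by (auto simp: dist_real_def)
    then have "0 < w * (f x0 + d - f x)" "0 < (1 - w) * (f x0 + d - f x)" using w by auto
    then show ?thesis using w by (auto simp: algebra_simps)
  qed
  have RU: "R \<subseteq> U"
  proof safe
    fix x y assume xy: "(x, y) \<in> R"
    then have "dist (f x0) y < d" "dist x0 x < d"
      using Rd[OF xy] near[of x] by (auto simp: dist_real_def)
    then show "(x, y) \<in> U" using d(2) by auto
  qed
  have RC: "R \<inter> C = {}" using Rd C by force
  have noaxis: "snd (h p) \<noteq> 0" if "p \<in> R" for p
  proof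
    assume "snd (h p) = 0"
    then obtain c where "c \<in> C \<inter> U" "h c = h p" using hC by (metis (mono_tags) imageE mem_Collect_eq)
    then show False using h that RU RC by (metis IntE disjoint_iff homeomorphism_apply1 subsetD)
  qed
  have "isCont h' (0, 0)"
    using h by (auto simp: homeomorphism_def continuous_on_eq_continuous_at)
  moreover have h'0: "h' (0, 0) = (x0, f x0)" using h h0 U(2) by (metis homeomorphism_apply1)
  moreover have "open (ball x0 e \<times> ball (f x0) d)" by (intro open_Times) auto
  ultimately have "\<forall>\<^sub>F z in nhds (0, 0). h' z \<in> ball x0 e \<times> ball (f x0) d"
    using e(1) d(1) by (intro topological_tendstoD[of h' "(x0, f x0)"]) (auto simp: isCont_def tendsto_nhds_iff)
  then obtain s where s: "0 < s" "\<And>z. dist z (0, 0) < s \<Longrightarrow> h' z \<in> ball x0 e \<times> ball (f x0) d"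
    unfolding eventually_nhds_metric by auto
  \<comment> \<open>The axis that is the image of \<open>D\<close>, punctured at the origin, pulls
    back near the touching point to points of \<open>D\<close> other than that point, and these lie
    strictly above \<open>C\<close>. Both signs of \<open>y\<close> occur, so \<open>snd\<close>
    after \<open>h\<close> takes both signs on \<open>R\<close>.\<close>
  have inR: "h' (0, y) \<in> R" if "y \<noteq> 0" "\<bar>y\<bar> < s" for y
  proof -
    have "(0, y) \<in> h ` (D \<inter> U)" using hD by auto
    then have "h' (0, y) \<in> D" using h by (auto simp: homeomorphism_apply1)
    then obtain x where x: "h' (0, y) = (x, f' x)" using D by auto
    have "h' (0, y) \<in> ball x0 e \<times> ball (f x0) d"
      using s(2)[of "(0, y)"] that by (auto simp: dist_Pair_Pair)
    moreover have "h' (0, y) \<noteq> (x0, f x0)"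
      using h that h0 by (metis UNIV_I homeomorphism_apply2 prod.inject)
    ultimately have "dist x x0 < e" "f' x < f x0 + d" "x \<noteq> x0"
      using x touch by (auto simp: dist_real_def)
    then show ?thesis using x R[of x "f' x"] less[of x] near[of x] by auto
  qed
  have "connected ((\<lambda>p. snd (h p)) ` R)"
    using connR RU h by (intro connected_continuous_image continuous_intros)
      (auto simp: homeomorphism_def elim: continuous_on_subset)
  moreover have "s / 2 \<in> (\<lambda>p. snd (h p)) ` R" "- s / 2 \<in> (\<lambda>p. snd (h p)) ` R"
    using inR[of "s / 2"] inR[of "- s / 2"] s(1) h
    by (auto simp: image_iff homeomorphism_apply2 intro!: bexI[of _ "h' (0, _)"])
  ultimately have "0 \<in> (\<lambda>p. snd (h p)) ` R"
    using s(1) by (auto simp: connected_iff_interval)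
  then show False using noaxis by auto
qed

text \<open>By the intermediate value theorem two graphs cannot change order inside a strip. The
  point \<open>p\<close> may be an end of the strip, so a strict inequality there settles the order
  in the whole interior even if the graphs meet at the other end.\<close>

lemma less_propagates:
  fixes f g :: "real \<Rightarrow> real"
  assumes cont: "continuous_on {s..t} f" "continuous_on {s..t} g"
    and ne: "\<And>x. s < x \<Longrightarrow> x < t \<Longrightarrow> f x \<noteq> g x"
    and p: "s \<le> p" "p \<le> t" "f p < g p" and x: "s < x" "x < t"
  shows "f x < g x"
proof (rule ccontr)
  assume "\<not> f x < g x"
  then have fx: "g x - f x \<le> 0" by simp
  have c: "continuous_on {min p x..max p x} (\<lambda>z. g z - f z)"
    by (rule continuous_on_subset[of "{s..t}"]) (use cont p x in \<open>auto intro!: continuous_intros\<close>)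
  obtain z where "min p x \<le> z" "z \<le> max p x" "g z - f z = 0"
  proof (cases "p \<le> x")
    case True
    then show thesis
      using IVT2'[of "\<lambda>z. g z - f z" x 0 p] c fx p that by auto
  next
    case False
    then show thesis
      using IVT'[of "\<lambda>z. g z - f z" x 0 p] c fx p that by auto
  qed
  moreover from this have "z \<noteq> p" using p by auto
  ultimately show False using ne[of z] p x by (auto simp: min_def max_def split: if_splits)
qed

text \<open>Zeros of \<open>f x - f' x\<close> exist on both sides of \<open>j\<close>; since the
  curves meet only once, both are \<open>j\<close> itself, which is then an interior touching point
  and so neither a proper crossing nor a common endpoint. Everything later uses the intersection
  conditions of the arrangement only in this form.\<close>

lemma graphs_cross_once:
  assumes C: "C = (\<lambda>x. (x, f x)) ` {l..r}" and D: "D = (\<lambda>x. (x, f' x)) ` {l'..r'}"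
    and cont: "continuous_on {l..r} f" "continuous_on {l'..r'} f'"
    and once: "meets_at_most_once C D"
    and trans: "\<And>p. p \<in> C \<inter> D \<Longrightarrow> proper_crossing C D p \<or> endpoint_of p C \<and> endpoint_of p D"
    and ijk: "i < j" "j < k" and dom: "l \<le> i" "l' \<le> i" "k \<le> r" "k \<le> r'"
  shows "\<not> (f i \<le> f' i \<and> f' j \<le> f j \<and> f k \<le> f' k)"
proof
  assume le: "f i \<le> f' i \<and> f' j \<le> f j \<and> f k \<le> f' k"
  have meet: "x = y" if "f x = f' x" "f y = f' y" "i \<le> x" "x \<le> k" "i \<le> y" "y \<le> k" for x y
  proof -
    have "(x, f x) \<in> C \<inter> D" "(y, f y) \<in> C \<inter> D" using that C D dom by auto
    then show ?thesis using once unfolding meets_at_most_once_def by blast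
  qed
  have sub: "continuous_on {s..t} f" "continuous_on {s..t} f'" if "i \<le> s" "t \<le> k" for s t
    using that dom cont by (auto elim!: continuous_on_subset)
  then have sub': "continuous_on {s..t} (\<lambda>x. f x - f' x)" if "i \<le> s" "t \<le> k" for s t
    using that by (intro continuous_intros)
  obtain x where "i \<le> x" "x \<le> j" "f x - f' x = 0"
    using IVT'[of "\<lambda>x. f x - f' x" i 0 j] sub'[of i j] le ijk by auto
  moreover obtain y where "j \<le> y" "y \<le> k" "f y - f' y = 0"
    using IVT2'[of "\<lambda>x. f x - f' x" k 0 j] sub'[of j k] le ijk by auto
  ultimately have j: "f j = f' j" using meet[of x y] ijk by auto
  have ne: "f x \<noteq> f' x" if "i \<le> x" "x \<le> k" "x \<noteq> j" for x
    using meet[of x j] that j ijk by auto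
  then have "f i < f' i" "f k < f' k" using le ijk by (auto simp: order_less_le)
  have less: "f x < f' x" if "i < x" "x < k" "x \<noteq> j" for x
  proof (cases "x < j")
    case True
    show ?thesis
      by (rule less_propagates[of i j f f' i]) (use sub[of i j] ne ijk \<open>f i < f' i\<close> True that in auto)
  next
    case False
    show ?thesis
      by (rule less_propagates[of j k f f' k]) (use sub[of j k] ne ijk \<open>f k < f' k\<close> False that in auto)
  qed
  have "(j, f j) \<in> C \<inter> D" using C D dom ijk j by auto
  moreover have "\<not> endpoint_of (j, f j) C" using endpoint_of_graph[OF C] dom ijk by fastforce
  moreover have "\<not> proper_crossing C D (j, f j)"
    using not_proper_crossing_if_touching[OF C D cont(1) _ _ j, of i k] less ijk dom by auto
  ultimately show False using trans by blast
qed

section \<open>Pushing a path off doubly crossed curves\<close>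

text \<open>The assumptions are preserved when \<open>f\<close>, \<open>ya\<close> and
  \<open>yb\<close> are negated: in \<open>cross_once\<close> this merely exchanges \<open>C\<close>
  and \<open>D\<close>. Hence pushing down is obtained by interpreting the locale for the mirror
  image.\<close>

locale graph_heights =
  fixes A :: "'c set" and l r :: "'c \<Rightarrow> real" and f :: "'c \<Rightarrow> real \<Rightarrow> real"
    and T :: "real set" and a ya b yb :: real
  assumes finA: "finite A" and finT: "finite T"
    and T_range: "\<And>t. t \<in> T \<Longrightarrow> a \<le> t \<and> t \<le> b" and ab: "a < b"
    and cross_once: "\<And>C D i j k. \<lbrakk>C \<in> A; D \<in> A; C \<noteq> D; i < j; j < k;
        l C \<le> i; l D \<le> i; k \<le> r C; k \<le> r D\<rbrakk> \<Longrightarrow>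
        \<not> (f C i \<le> f D i \<and> f D j \<le> f C j \<and> f C k \<le> f D k)"
    and no_common: "\<And>C. \<lbrakk>C \<in> A; l C \<le> a; b \<le> r C\<rbrakk> \<Longrightarrow> \<not> (f C a = ya \<and> f C b = yb)"
begin

text \<open>A height function records where a path from \<open>(a, ya)\<close> to \<open>(b, yb)\<close> passes the abscissas in
  \<open>T\<close>; only its two ends may lie on curves. The outer inequalities in \<open>up_down\<close> and \<open>down_up\<close> are
  weak, so that a curve through one of the ends must not be crossed at all.\<close>

definition heights :: "(real \<Rightarrow> real) \<Rightarrow> bool" where
  "heights g \<longleftrightarrow> g a = ya \<and> g b = yb \<and>
     (\<forall>t\<in>T. \<forall>C\<in>A. a < t \<and> t < b \<and> l C \<le> t \<and> t \<le> r C \<longrightarrow> g t \<noteq> f C t)"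

definition up_down :: "(real \<Rightarrow> real) \<Rightarrow> bool" where
  "up_down g \<longleftrightarrow> (\<exists>C\<in>A. \<exists>i\<in>T. \<exists>j\<in>T. \<exists>k\<in>T. i < j \<and> j < k \<and> l C \<le> i \<and> k \<le> r C \<and>
     g i \<le> f C i \<and> f C j < g j \<and> g k \<le> f C k)"

definition down_up :: "(real \<Rightarrow> real) \<Rightarrow> bool" where
  "down_up g \<longleftrightarrow> (\<exists>C\<in>A. \<exists>i\<in>T. \<exists>j\<in>T. \<exists>k\<in>T. i < j \<and> j < k \<and> l C \<le> i \<and> k \<le> r C \<and>
     f C i \<le> g i \<and> g j < f C j \<and> f C k \<le> g k)"

lemma heights_exist: "\<exists>g. heights g"
proof -
  have "\<exists>y. y \<notin> (\<lambda>C. f C t) ` A" for t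
    using finA by (meson finite_imageI ex_new_if_finite infinite_UNIV_char_0)
  then obtain h where "\<And>t. h t \<notin> (\<lambda>C. f C t) ` A" by metis
  then have "heights (\<lambda>t. if t = a then ya else if t = b then yb else h t)"
    using ab by (auto simp: heights_def image_iff) 
  then show ?thesis by blast
qed

text \<open>Finiteness provides one amount \<open>e\<close> by which a path can rise above a curve
  at any abscissa of \<open>T\<close> without reaching the next higher curve there.\<close>

lemma gap_exists: "\<exists>e>0. \<forall>t\<in>T. \<forall>C\<in>A. \<forall>D\<in>A. f C t < f D t \<longrightarrow> f C t + e < f D t"
proof -
  define S where "S = {d \<in> (\<lambda>(t, C, D). f D t - f C t) ` (T \<times> A \<times> A). 0 < d}"
  have S: "finite (insert 1 S)" using finA finT by (auto simp: S_def)
  \<comment> \<open>The extra element 1 keeps the minimum defined when no positive difference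
    occurs; halving it makes the required inequality strict.\<close>
  define e where "e = Min (insert 1 S) / 2"
  have "0 < Min (insert 1 S)" using S by (subst Min_gr_iff) (auto simp: S_def)
  then have e: "0 < e" by (simp add: e_def)
  have "e < d" if "d \<in> S" for d
  proof -
    have "Min (insert 1 S) \<le> d" using S that by (intro Min_le) auto
    then show ?thesis using e by (simp add: e_def)
  qed
  moreover have "f D t - f C t \<in> S" if "t \<in> T" "C \<in> A" "D \<in> A" "f C t < f D t" for t C D
    using that by (force simp: S_def)
  ultimately have "\<forall>t\<in>T. \<forall>C\<in>A. \<forall>D\<in>A. f C t < f D t \<longrightarrow> f C t + e < f D t" by fastforce
  then show ?thesis using e by blast
qed

text \<open>If raising the path over \<open>C\<close> between \<open>u\<close> and \<open>v\<close> made it go up and then down through \<open>D\<close>, then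
  either the old path already did so or \<open>D\<close> would have to cross \<open>C\<close> twice.\<close>

lemma push_up:
  assumes g: "heights g" and viol: "down_up g"
  shows "\<exists>g'. heights g' \<and> (\<not> up_down g \<longrightarrow> \<not> up_down g') \<and>
    {(t, C) \<in> T \<times> A. f C t < g t} \<subset> {(t, C) \<in> T \<times> A. f C t < g' t}"
proof -
  obtain C u w v where C: "C \<in> A" and T: "u \<in> T" "w \<in> T" "v \<in> T" and uwv: "u < w" "w < v"
    and dom: "l C \<le> u" "v \<le> r C" and Cg: "f C u \<le> g u" "g w < f C w" "f C v \<le> g v"
    using viol by (auto simp: down_up_def)
  obtain e where e: "0 < e"
      "\<And>t C D. \<lbrakk>t \<in> T; C \<in> A; D \<in> A; f C t < f D t\<rbrakk> \<Longrightarrow> f C t + e < f D t"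
    using gap_exists by blast
  \<comment> \<open>Taking the maximum leaves the path alone where it already runs higher. The ends
    \<open>u\<close> and \<open>v\<close> keep their heights, so that \<open>a\<close> and
    \<open>b\<close> are never moved.\<close>
  define g' where "g' t = (if u < t \<and> t < v then max (g t) (f C t + e) else g t)" for t
  have ge: "g t \<le> g' t" for t by (simp add: g'_def)
  have uv: "a \<le> u" "v \<le> b" using T T_range by auto
  have "heights g'"
    unfolding heights_def
  proof (intro conjI ballI impI)
    show "g' a = ya" "g' b = yb" using g uv by (auto simp: g'_def heights_def)
    fix t D assume t: "t \<in> T" "D \<in> A" "a < t \<and> t < b \<and> l D \<le> t \<and> t \<le> r D"
    then have "g t \<noteq> f D t" using g by (auto simp: heights_def)
    moreover have "f C t + e \<noteq> f D t" using e(1) e(2)[of t C D] t C by force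
    ultimately show "g' t \<noteq> f D t" by (auto simp: g'_def max_def)
  qed
  moreover have "{(t, C) \<in> T \<times> A. f C t < g t} \<subset> {(t, C) \<in> T \<times> A. f C t < g' t}"
  proof
    show "{(t, C) \<in> T \<times> A. f C t < g t} \<subseteq> {(t, C) \<in> T \<times> A. f C t < g' t}"
      using ge by (auto intro: less_le_trans)
    have "f C w < g' w" using e(1) uwv by (auto simp: g'_def less_max_iff_disj)
    then have "(w, C) \<in> {(t, C) \<in> T \<times> A. f C t < g' t} - {(t, C) \<in> T \<times> A. f C t < g t}"
      using C T(2) Cg(2) by simp
    then show "{(t, C) \<in> T \<times> A. f C t < g t} \<noteq> {(t, C) \<in> T \<times> A. f C t < g' t}"
      by blast
  qed
  moreover have "up_down g" if "up_down g'"
  proof (rule ccontr)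
    assume no: "\<not> up_down g"
    obtain D i j k where D: "D \<in> A" and ijk: "i \<in> T" "j \<in> T" "k \<in> T" "i < j" "j < k"
      and domD: "l D \<le> i" "k \<le> r D" and Dg': "g' i \<le> f D i" "f D j < g' j" "g' k \<le> f D k"
      using \<open>up_down g'\<close> by (auto simp: up_down_def)
    have Dg: "g i \<le> f D i" "g k \<le> f D k" using ge Dg' by (meson order_trans)+
    have below: "g t \<le> f D t" if "t \<in> T" "i < t" "t < k" for t
      using no D ijk domD Dg that unfolding up_down_def by (meson not_le)
    have "g j \<le> f D j" using below ijk by blast
    \<comment> \<open>The old path is not above \<open>D\<close> at \<open>j\<close>, so the new
      path is above \<open>D\<close> there only because it was raised. By the choice of
      \<open>e\<close>, no curve strictly above \<open>C\<close> was passed, hence \<open>D\<close>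
      is not above \<open>C\<close> at \<open>j\<close>.\<close>
    then have juv: "u < j" "j < v" and "f D j < f C j + e"
      using Dg'(2) by (auto simp: g'_def less_max_iff_disj split: if_splits)
    then have DC: "f D j \<le> f C j" using e(2)[of j C D] C D ijk by force
    \<comment> \<open>Inside the pushed stretch the new path is strictly above \<open>C\<close>, so
      a curve not below the new path is strictly above \<open>C\<close> as well.\<close>
    have inside: "f C t < f D t" if "g' t \<le> f D t" "u < t" "t < v" for t
      using that e(1) by (auto simp: g'_def)
    show False
    \<comment> \<open>If \<open>C = D\<close>, the path lies on \<open>C\<close> at \<open>u\<close>
      and at \<open>v\<close>; heights avoid the curves except at the two ends, so \<open>C\<close>
      would contain both ends of the path. Otherwise \<open>C\<close> is weakly below
      \<open>D\<close> at both ends of the common stretch and weakly above it at \<open>j\<close>,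
      against \<open>cross_once\<close>.\<close>
    proof (cases "C = D")
      case True
      then have "i \<le> u" "v \<le> k" using inside[of i] inside[of k] Dg' juv ijk by fastforce+
      then have "g u \<le> f C u" "g v \<le> f C v"
        using below[of u] below[of v] Dg T juv ijk True by (cases "i = u"; cases "v = k"; force)+
      then have eq: "g u = f C u" "g v = f C v" using Cg by auto
      then have "u = a" "v = b" using g C T dom uwv uv by (force simp: heights_def)+
      then show False using no_common[of C] eq g C dom by (auto simp: heights_def)
    next
      case False
      have "f C (max i u) \<le> f D (max i u)"
      proof (cases "u < i")
        case True
        then show ?thesis using inside[of i] Dg' juv ijk by (simp add: max_def)
      next
        case F: False
        then have "g u \<le> f D u" using below[of u] Dg T juv ijk by (cases "u = i") auto
        then show ?thesis using F Cg by (simp add: max_def)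
      qed
      moreover have "f C (min k v) \<le> f D (min k v)"
      proof (cases "k < v")
        case True
        then show ?thesis using inside[of k] Dg' juv ijk by (simp add: min_def)
      next
        case F: False
        then have "g v \<le> f D v" using below[of v] Dg T juv ijk by (cases "v = k") auto
        then show ?thesis using F Cg by (simp add: min_def)
      qed
      ultimately show False
        using cross_once[OF C D False, of "max i u" j "min k v"] DC dom domD juv ijk
        by (auto simp: le_max_iff_disj min_le_iff_disj)
    qed
  qed
  ultimately show ?thesis by blast
qed

text \<open>Each push strictly enlarges the set of pairs of an abscissa and a curve strictly below
  the path. This set stays within the finite set \<open>T \<times> A\<close>, so its complement
  serves as termination measure.\<close>

lemma push_up_exhaustively:
  assumes "heights g"
  shows "\<exists>g'. heights g' \<and> \<not> down_up g' \<and> (\<not> up_down g \<longrightarrow> \<not> up_down g')"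
  using assms
proof (induction "card (T \<times> A - {(t, C) \<in> T \<times> A. f C t < g t})" arbitrary: g rule: less_induct)
  case less
  show ?case
  proof (cases "down_up g")
    case True
    then obtain g' where g': "heights g'" "\<not> up_down g \<longrightarrow> \<not> up_down g'"
        "{(t, C) \<in> T \<times> A. f C t < g t} \<subset> {(t, C) \<in> T \<times> A. f C t < g' t}"
      using push_up[OF less.prems] by blast
    then have "T \<times> A - {(t, C) \<in> T \<times> A. f C t < g' t} \<subset> T \<times> A - {(t, C) \<in> T \<times> A. f C t < g t}"
      by blast
    then have "card (T \<times> A - {(t, C) \<in> T \<times> A. f C t < g' t})
        < card (T \<times> A - {(t, C) \<in> T \<times> A. f C t < g t})"
      using finA finT by (intro psubset_card_mono) auto
    then show ?thesis using less.hyps[of g'] g' by blast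
  qed (use less.prems in blast)
qed

text \<open>Pushing up in the mirror image removes all \<open>up_down\<close> patterns of the
  original; pushing up afterwards in the original removes the \<open>down_up\<close> patterns
  without recreating the former.\<close>

lemma taut_heights_exist: "\<exists>g. heights g \<and> \<not> up_down g \<and> \<not> down_up g"
proof -
  interpret neg: graph_heights A l r "\<lambda>C x. - f C x" T a "- ya" b "- yb"
    using finA finT T_range ab no_common
    by unfold_locales (auto dest: cross_once)
  obtain h where h: "neg.heights h" "\<not> neg.down_up h"
    using neg.heights_exist neg.push_up_exhaustively by blast
  have neg_iff: "- h t = f C t \<longleftrightarrow> h t = - f C t" "- h t \<le> f C t \<longleftrightarrow> - f C t \<le> h t"
      "f C t < - h t \<longleftrightarrow> h t < - f C t" for t C
    by linarith+
  have "heights (\<lambda>t. - h t)"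
    using h(1) unfolding heights_def neg.heights_def neg_iff by simp
  moreover have "\<not> up_down (\<lambda>t. - h t)"
    using h(2) unfolding up_down_def neg.down_up_def neg_iff .
  ultimately show ?thesis using push_up_exhaustively by blast
qed

end

section \<open>Realising heights by a curve\<close>

text \<open>The base function \<open>L\<close> keeps the maximum meaningful for empty
  \<open>B\<close>. Since the envelope is attained by some member at each point, comparing two
  envelopes reduces to comparing members.\<close>

lemma finite_upper_envelope:
  fixes f :: "'c \<Rightarrow> real \<Rightarrow> real"
  assumes "finite B" "continuous_on S L" "\<And>C. C \<in> B \<Longrightarrow> continuous_on S (f C)"
  shows "\<exists>\<beta>. continuous_on S \<beta> \<and> (\<forall>x. L x \<le> \<beta> x) \<and> (\<forall>C\<in>B. \<forall>x. f C x \<le> \<beta> x) \<and>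
           (\<forall>x. \<beta> x = L x \<or> (\<exists>C\<in>B. \<beta> x = f C x))"
  using assms(1,3)
proof (induction B rule: finite_induct)
  case empty
  then show ?case using assms(2) by auto
next
  case (insert D B)
  then obtain \<beta> where "continuous_on S \<beta>" "\<forall>x. L x \<le> \<beta> x" "\<forall>C\<in>B. \<forall>x. f C x \<le> \<beta> x"
      "\<forall>x. \<beta> x = L x \<or> (\<exists>C\<in>B. \<beta> x = f C x)"
    by auto
  moreover have "continuous_on S (\<lambda>x. max (\<beta> x) (f D x))"
    using calculation(1) insert.prems[of D] by (intro continuous_on_max) auto
  ultimately show ?case
    by (intro exI[of _ "\<lambda>x. max (\<beta> x) (f D x)"]) (auto simp: max_def intro: order_trans)
qed

text \<open>Every curve lies weakly below both prescribed ends or weakly above both. The path is the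
  straight segment between the ends, clamped into the open gap between the upper envelope of the
  lower curves and the lower envelope of the upper curves.\<close>

lemma strip_path_between:
  fixes f :: "'c \<Rightarrow> real \<Rightarrow> real"
  assumes fin: "finite F" and st: "s < t"
    and cont: "\<And>C. C \<in> F \<Longrightarrow> continuous_on {s..t} (f C)"
    and ne: "\<And>C D x. C \<in> F \<Longrightarrow> D \<in> F \<Longrightarrow> C \<noteq> D \<Longrightarrow> s < x \<Longrightarrow> x < t \<Longrightarrow> f C x \<noteq> f D x"
    and ends: "\<And>C. C \<in> F \<Longrightarrow> \<not> (f C s = ys \<and> f C t = yt)"
    and same: "\<And>C. C \<in> F \<Longrightarrow> f C s \<le> ys \<and> f C t \<le> yt \<or> ys \<le> f C s \<and> yt \<le> f C t"
  shows "\<exists>\<gamma>. continuous_on {s..t} \<gamma> \<and> \<gamma> s = ys \<and> \<gamma> t = yt \<and>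
           (\<forall>C\<in>F. \<forall>x. s < x \<and> x < t \<longrightarrow> \<gamma> x \<noteq> f C x)"
proof -
  define L where "L x = ys + (x - s) / (t - s) * (yt - ys)" for x
  have Ls: "L s = ys" and Lt: "L t = yt" using st by (auto simp: L_def)
  have Lc: "continuous_on {s..t} L" unfolding L_def by (intro continuous_intros) (use st in auto)
  define B where "B = {C \<in> F. f C s \<le> ys \<and> f C t \<le> yt}"
  define A where "A = {C \<in> F. ys \<le> f C s \<and> yt \<le> f C t}"
  \<comment> \<open>\<open>\<mu>\<close> and \<open>- \<nu>\<close> bound the segment and all curves
    from above and below. Moved outwards by 1 they are safe base functions for the two envelopes,
    even when one of the families is empty.\<close>
  obtain \<mu> where \<mu>: "continuous_on {s..t} \<mu>" "\<And>x. L x \<le> \<mu> x" "\<And>C x. C \<in> F \<Longrightarrow> f C x \<le> \<mu> x"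
    using finite_upper_envelope[of F "{s..t}" L f] fin Lc cont by auto
  obtain \<nu> where \<nu>: "continuous_on {s..t} \<nu>" "\<And>x. - L x \<le> \<nu> x" "\<And>C x. C \<in> F \<Longrightarrow> - f C x \<le> \<nu> x"
    using finite_upper_envelope[of F "{s..t}" "\<lambda>x. - L x" "\<lambda>C x. - f C x"] fin
      continuous_on_minus[OF Lc] continuous_on_minus[OF cont] by auto
  obtain \<beta> where \<beta>: "continuous_on {s..t} \<beta>" "\<And>C x. C \<in> B \<Longrightarrow> f C x \<le> \<beta> x"
      "\<And>x. \<beta> x = - \<nu> x - 1 \<or> (\<exists>C\<in>B. \<beta> x = f C x)"
  proof -
    have "continuous_on {s..t} (\<lambda>x. - \<nu> x - 1)" using \<nu>(1) by (intro continuous_intros)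
    then show thesis
      using finite_upper_envelope[of B "{s..t}" "\<lambda>x. - \<nu> x - 1" f] fin cont that
      by (auto simp: B_def)
  qed
  obtain \<alpha>' where \<alpha>': "continuous_on {s..t} \<alpha>'" "\<And>C x. C \<in> A \<Longrightarrow> - f C x \<le> \<alpha>' x"
      "\<And>x. \<alpha>' x = - \<mu> x - 1 \<or> (\<exists>C\<in>A. \<alpha>' x = - f C x)"
  proof -
    have "continuous_on {s..t} (\<lambda>x. - \<mu> x - 1)" using \<mu>(1) by (intro continuous_intros)
    moreover have "continuous_on {s..t} (\<lambda>x. - f C x)" if "C \<in> A" for C
      using that cont by (intro continuous_intros) (auto simp: A_def)
    ultimately show thesis
      using finite_upper_envelope[of A "{s..t}" "\<lambda>x. - \<mu> x - 1" "\<lambda>C x. - f C x"] fin that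
      by (auto simp: A_def)
  qed
  define \<alpha> where "\<alpha> x = - \<alpha>' x" for x
  have \<alpha>c: "continuous_on {s..t} \<alpha>" unfolding \<alpha>_def using \<alpha>'(1) by (intro continuous_intros)
  have \<alpha>le: "\<alpha> x \<le> f C x" if "C \<in> A" for C x using \<alpha>'(2)[OF that, of x] by (simp add: \<alpha>_def)
  have \<alpha>eq: "\<alpha> x = \<mu> x + 1 \<or> (\<exists>C\<in>A. \<alpha> x = f C x)" for x
    using \<alpha>'(3)[of x] by (auto simp: \<alpha>_def)
  \<comment> \<open>The ends of the path lie between \<open>C\<close> and \<open>D\<close>. If
    \<open>C\<close> and \<open>D\<close> agreed at both ends of the strip, \<open>C\<close> would
    pass through both prescribed points, against \<open>ends\<close>; the strict inequality at one
    end propagates inwards.\<close>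
  have BA: "f C x < f D x" if "C \<in> B" "D \<in> A" "s < x" "x < t" for C D x
  proof -
    have CD: "f C s < f D s \<or> f C t < f D t" "C \<in> F" "D \<in> F"
      using that ends[of C] ends[of D] by (force simp: A_def B_def)+
    then have "C \<noteq> D" by auto
    then show ?thesis
      using CD(1) less_propagates[of s t "f C" "f D" s x] less_propagates[of s t "f C" "f D" t x]
        cont[OF CD(2)] cont[OF CD(3)] ne[OF CD(2,3)] that st by auto
  qed
  have lt: "\<beta> x < \<alpha> x" if "s < x" "x < t" for x
    using \<beta>(3)[of x] \<alpha>eq[of x]
  proof (elim disjE bexE)
    assume "\<beta> x = - \<nu> x - 1" "\<alpha> x = \<mu> x + 1"
    then show ?thesis using \<mu>(2)[of x] \<nu>(2)[of x] by linarith
  next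
    fix D assume "\<beta> x = - \<nu> x - 1" "D \<in> A" "\<alpha> x = f D x"
    then show ?thesis using \<nu>(3)[of D x] by (auto simp: A_def)
  next
    fix C assume "C \<in> B" "\<beta> x = f C x" "\<alpha> x = \<mu> x + 1"
    then show ?thesis using \<mu>(3)[of C x] by (auto simp: B_def)
  next
    fix C D assume "C \<in> B" "\<beta> x = f C x" "D \<in> A" "\<alpha> x = f D x"
    then show ?thesis using BA that by auto
  qed
  have atends: "\<beta> x \<le> L x \<and> L x \<le> \<alpha> x" if "x = s \<or> x = t" for x
    using \<beta>(3)[of x] \<alpha>eq[of x] that Ls Lt \<mu>(2)[of x] \<nu>(2)[of x] by (auto simp: A_def B_def)
  \<comment> \<open>The margin \<open>w\<close> vanishes at \<open>s\<close> and \<open>t\<close>,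
    so the clamping does not alter the prescribed ends. Inside it is positive and at most 1/3, which
    keeps the clamped path strictly between \<open>\<beta>\<close> and
    \<open>\<alpha>\<close>.\<close>
  define w where "w x = min (1/3) ((x - s) * (t - x))" for x
  define \<gamma> where "\<gamma> x = max (\<beta> x + w x * (\<alpha> x - \<beta> x)) (min (L x) (\<alpha> x - w x * (\<alpha> x - \<beta> x)))" for x
  have "continuous_on {s..t} \<gamma>"
    unfolding \<gamma>_def w_def using \<alpha>c \<beta>(1) Lc by (intro continuous_intros)
  moreover have "\<gamma> s = ys" "\<gamma> t = yt"
    using atends[of s] atends[of t] Ls Lt by (auto simp: \<gamma>_def w_def)
  moreover have "\<gamma> x \<noteq> f C x" if "C \<in> F" "s < x" "x < t" for C x
  proof -
    have "0 < w x" "w x \<le> 1/3" using that by (auto simp: w_def)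
    then have "0 < w x * (\<alpha> x - \<beta> x)" "w x * (\<alpha> x - \<beta> x) \<le> 1/3 * (\<alpha> x - \<beta> x)"
      using lt[OF that(2,3)] by (auto intro: mult_right_mono)
    then have "\<beta> x < \<gamma> x" "\<gamma> x < \<alpha> x" by (auto simp: \<gamma>_def)
    moreover have "C \<in> B \<or> C \<in> A" using same[OF that(1)] that(1) by (auto simp: A_def B_def)
    ultimately show ?thesis using \<beta>(2)[of C x] \<alpha>le[of C x] by force
  qed
  ultimately show ?thesis by blast
qed

text \<open>The negative product says that \<open>C\<close> strictly separates the two prescribed
  ends. If some \<open>U\<close> does, the path is led through a point of \<open>U\<close> at the
  middle of the strip; every half then has fewer separating curves, and
  \<open>strip_path_between\<close> covers the case of none.\<close>

lemma strip_path:
  fixes f :: "'c \<Rightarrow> real \<Rightarrow> real"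
  assumes fin: "finite F"
  shows "\<lbrakk>s < t; \<And>C. C \<in> F \<Longrightarrow> continuous_on {s..t} (f C);
      \<And>C D x. C \<in> F \<Longrightarrow> D \<in> F \<Longrightarrow> C \<noteq> D \<Longrightarrow> s < x \<Longrightarrow> x < t \<Longrightarrow> f C x \<noteq> f D x;
      \<And>C. C \<in> F \<Longrightarrow> \<not> (f C s = ys \<and> f C t = yt)\<rbrakk> \<Longrightarrow>
    \<exists>\<gamma>. continuous_on {s..t} \<gamma> \<and> \<gamma> s = ys \<and> \<gamma> t = yt \<and>
      (\<forall>C\<in>F. (\<forall>x. s < x \<and> x < t \<and> \<gamma> x = f C x \<longrightarrow> (ys - f C s) * (yt - f C t) < 0) \<and>
        (\<forall>x y. s < x \<and> x < t \<and> s < y \<and> y < t \<and> \<gamma> x = f C x \<and> \<gamma> y = f C y \<longrightarrow> x = y))"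
proof (induction "card {C \<in> F. (ys - f C s) * (yt - f C t) < 0}" arbitrary: s t ys yt rule: less_induct)
  case less
  note st = less.prems(1) and cont = less.prems(2) and ne = less.prems(3) and ends = less.prems(4)
  let ?X = "\<lambda>s t ys yt. {C \<in> F. (ys - f C s) * (yt - f C t) < 0}"
  show ?case
  proof (cases "?X s t ys yt = {}")
    case True
    then have "f C s \<le> ys \<and> f C t \<le> yt \<or> ys \<le> f C s \<and> yt \<le> f C t" if "C \<in> F" for C
      using that by (auto simp: mult_less_0_iff not_less)
    from strip_path_between[of F s t f ys yt, OF fin st cont ne ends this] obtain \<gamma> where
      "continuous_on {s..t} \<gamma>" "\<gamma> s = ys" "\<gamma> t = yt" "\<forall>C\<in>F. \<forall>x. s < x \<and> x < t \<longrightarrow> \<gamma> x \<noteq> f C x"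
      by auto
    then show ?thesis by (intro exI[of _ \<gamma>]) auto
  next
    case False
    then obtain U where U: "U \<in> F" "(ys - f U s) * (yt - f U t) < 0" by auto
    define m where "m = (s + t) / 2"
    have m: "s < m" "m < t" using st by (auto simp: m_def)
    define ym where "ym = f U m"
    have below: "f C m < ym" if "C \<in> F" "f C s < f U s \<or> f C t < f U t" for C
      using that less_propagates[of s t "f C" "f U" s m] less_propagates[of s t "f C" "f U" t m]
        cont[of C] cont[of U] ne[of C U] U(1) m st by (cases "C = U") (auto simp: ym_def)
    have above: "ym < f C m" if "C \<in> F" "f U s < f C s \<or> f U t < f C t" for C
      using that less_propagates[of s t "f U" "f C" s m] less_propagates[of s t "f U" "f C" t m]
        cont[of C] cont[of U] ne[of U C] U(1) m st by (cases "C = U") (auto simp: ym_def)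
    have nem: "f C m \<noteq> ym" if "C \<in> F" "C \<noteq> U" for C
      using ne[of C U m] that U(1) m by (auto simp: ym_def)
    have neU: "f U s \<noteq> ys" "f U t \<noteq> yt" using U(2) by auto
    \<comment> \<open>Curves do not cross inside the strip, so a curve above \<open>U\<close> at
      \<open>m\<close> is weakly above \<open>U\<close> at \<open>s\<close> and \<open>t\<close>
      too, and likewise below. As \<open>ys\<close> and \<open>yt\<close> are on opposite sides of
      \<open>U\<close>, such a curve can separate a half only if it separates the whole.\<close>
    have sub: "(ys - f C s) * (yt - f C t) < 0 \<and> C \<noteq> U"
      if "C \<in> F" "(ys - f C s) * (ym - f C m) < 0 \<or> (ym - f C m) * (yt - f C t) < 0" for C
    proof -
      have "C \<noteq> U" using that by (auto simp: ym_def)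
      moreover have "(ys - f C s) * (yt - f C t) < 0"
      proof (cases "ym < f C m")
        case True
        then have "f U s \<le> f C s" "f U t \<le> f C t" using below[of C] that(1) by force+
        then show ?thesis using True that(2) U(2) by (auto simp: mult_less_0_iff)
      next
        case False
        then have "f C m < ym" using that(2) by (cases "f C m = ym") auto
        moreover from this have "f C s \<le> f U s" "f C t \<le> f U t" using above[of C] that(1) by force+
        ultimately show ?thesis using that(2) U(2) by (auto simp: mult_less_0_iff)
      qed
      ultimately show ?thesis by auto
    qed
    \<comment> \<open>Separating both halves would put \<open>ys\<close> and \<open>yt\<close> on
      the same side of \<open>C\<close>, contradicting \<open>sub\<close>. So the two partial paths
      do not meet the same curve in their interiors.\<close>
    have one: "\<not> ((ys - f C s) * (ym - f C m) < 0 \<and> (ym - f C m) * (yt - f C t) < 0)"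
      if "C \<in> F" for C
      using sub[of C] that by (auto simp: mult_less_0_iff)
    \<comment> \<open>\<open>U\<close> separates the ends of the whole strip but of neither half,
      because the intermediate point lies on it.\<close>
    have "card (?X s m ys ym) < card (?X s t ys yt)" "card (?X m t ym yt) < card (?X s t ys yt)"
      by (rule psubset_card_mono; use fin sub U in \<open>fastforce simp: psubset_eq\<close>)+
    note IH = less.hyps[OF this(1)] less.hyps[OF this(2)]
    obtain \<gamma>1 where \<gamma>1: "continuous_on {s..m} \<gamma>1" "\<gamma>1 s = ys" "\<gamma>1 m = ym"
      "\<And>C x. C \<in> F \<Longrightarrow> s < x \<Longrightarrow> x < m \<Longrightarrow> \<gamma>1 x = f C x \<Longrightarrow> (ys - f C s) * (ym - f C m) < 0"
      "\<And>C x y. C \<in> F \<Longrightarrow> s < x \<Longrightarrow> x < m \<Longrightarrow> s < y \<Longrightarrow> y < m \<Longrightarrow> \<gamma>1 x = f C x \<Longrightarrow> \<gamma>1 y = f C y \<Longrightarrow> x = y"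
    proof -
      have "\<exists>\<gamma>. continuous_on {s..m} \<gamma> \<and> \<gamma> s = ys \<and> \<gamma> m = ym \<and>
      (\<forall>C\<in>F. (\<forall>x. s < x \<and> x < m \<and> \<gamma> x = f C x \<longrightarrow> (ys - f C s) * (ym - f C m) < 0) \<and>
        (\<forall>x y. s < x \<and> x < m \<and> s < y \<and> y < m \<and> \<gamma> x = f C x \<and> \<gamma> y = f C y \<longrightarrow> x = y))"
      proof (rule IH(1))
        show "continuous_on {s..m} (f C)" if "C \<in> F" for C
          using cont[OF that] m by (auto elim: continuous_on_subset)
        show "\<not> (f C s = ys \<and> f C m = ym)" if "C \<in> F" for C
          using nem[OF that] neU by (cases "C = U") auto
      qed (use m ne in auto)
      then show thesis using that by blast
    qed
    obtain \<gamma>2 where \<gamma>2: "continuous_on {m..t} \<gamma>2" "\<gamma>2 m = ym" "\<gamma>2 t = yt"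
      "\<And>C x. C \<in> F \<Longrightarrow> m < x \<Longrightarrow> x < t \<Longrightarrow> \<gamma>2 x = f C x \<Longrightarrow> (ym - f C m) * (yt - f C t) < 0"
      "\<And>C x y. C \<in> F \<Longrightarrow> m < x \<Longrightarrow> x < t \<Longrightarrow> m < y \<Longrightarrow> y < t \<Longrightarrow> \<gamma>2 x = f C x \<Longrightarrow> \<gamma>2 y = f C y \<Longrightarrow> x = y"
    proof -
      have "\<exists>\<gamma>. continuous_on {m..t} \<gamma> \<and> \<gamma> m = ym \<and> \<gamma> t = yt \<and>
      (\<forall>C\<in>F. (\<forall>x. m < x \<and> x < t \<and> \<gamma> x = f C x \<longrightarrow> (ym - f C m) * (yt - f C t) < 0) \<and>
        (\<forall>x y. m < x \<and> x < t \<and> m < y \<and> y < t \<and> \<gamma> x = f C x \<and> \<gamma> y = f C y \<longrightarrow> x = y))"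
      proof (rule IH(2))
        show "continuous_on {m..t} (f C)" if "C \<in> F" for C
          using cont[OF that] m by (auto elim: continuous_on_subset)
        show "\<not> (f C m = ym \<and> f C t = yt)" if "C \<in> F" for C
          using nem[OF that] neU by (cases "C = U") auto
      qed (use m ne in auto)
      then show thesis using that by blast
    qed
    define \<gamma> where "\<gamma> x = (if x \<le> m then \<gamma>1 x else \<gamma>2 x)" for x
    have "continuous_on ({s..m} \<union> {m..t}) \<gamma>"
      unfolding \<gamma>_def using \<gamma>1(1,3) \<gamma>2(1,2) by (intro continuous_on_If) auto
    moreover have "{s..m} \<union> {m..t} = {s..t}" using m by auto
    ultimately have c: "continuous_on {s..t} \<gamma>" by simp
    have meet: "(x < m \<and> (ys - f C s) * (ym - f C m) < 0) \<or> (x = m \<and> C = U) \<or>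
        (m < x \<and> (ym - f C m) * (yt - f C t) < 0)"
      if "C \<in> F" "s < x" "x < t" "\<gamma> x = f C x" for C x
      using that \<gamma>1(3) \<gamma>1(4)[of C x] \<gamma>2(4)[of C x] nem[of C]
      by (cases x m rule: linorder_cases) (auto simp: \<gamma>_def)
    have "(ys - f C s) * (yt - f C t) < 0" if "C \<in> F" "s < x" "x < t" "\<gamma> x = f C x" for C x
      using meet[OF that] sub[of C] U that by auto
    moreover have "x = y" if "C \<in> F" "s < x" "x < t" "s < y" "y < t" "\<gamma> x = f C x" "\<gamma> y = f C y" for C x y
      using meet[of C x] meet[of C y] one[of C] sub[of C] \<gamma>1(5)[of C x y] \<gamma>2(5)[of C x y] that
      by (auto simp: \<gamma>_def)
    moreover have "\<gamma> s = ys" "\<gamma> t = yt" using m \<gamma>1(2) \<gamma>2(3) by (auto simp: \<gamma>_def)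
    ultimately show ?thesis using c by (intro exI[of _ \<gamma>]) blast
  qed
qed

text \<open>The paths are joined by adding the largest abscissa last. Gluing redefines the function
  outside a strip, which is why \<open>Q\<close> has to depend only on the values within
  \<open>{s..t}\<close>.\<close>

lemma glue_strips:
  fixes g :: "real \<Rightarrow> real"
  assumes "finite T"
    and local: "\<And>s t \<gamma> \<delta>. Q s t \<gamma> \<Longrightarrow> (\<And>x. s \<le> x \<Longrightarrow> x \<le> t \<Longrightarrow> \<gamma> x = \<delta> x) \<Longrightarrow> Q s t \<delta>"
  shows "\<lbrakk>T \<noteq> {}; \<And>s t. \<lbrakk>s \<in> T; t \<in> T; s < t; \<And>u. u \<in> T \<Longrightarrow> \<not> (s < u \<and> u < t)\<rbrakk> \<Longrightarrow>
        \<exists>\<gamma>. continuous_on {s..t} \<gamma> \<and> \<gamma> s = g s \<and> \<gamma> t = g t \<and> Q s t \<gamma>\<rbrakk> \<Longrightarrow>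
      \<exists>\<gamma>. continuous_on {Min T..Max T} \<gamma> \<and> (\<forall>t\<in>T. \<gamma> t = g t) \<and>
        (\<forall>s\<in>T. \<forall>t\<in>T. s < t \<and> (\<forall>u\<in>T. \<not> (s < u \<and> u < t)) \<longrightarrow> Q s t \<gamma>)"
  using assms(1)
proof (induction T rule: finite_linorder_max_induct)
  case (insert t T)
  show ?case
  proof (cases "T = {}")
    case True
    \<comment> \<open>A single abscissa gives a degenerate interval and no strips, so a constant
      function suffices.\<close>
    then show ?thesis by (intro exI[of _ "\<lambda>_. g t"]) auto
  next
    case False
    define c where "c = Max T"
    have c: "c \<in> T" "c < t" "\<And>s. s \<in> T \<Longrightarrow> s \<le> c"
      using insert.hyps False by (auto simp: c_def)
    have MinMax: "Min (insert t T) = Min T" "Max (insert t T) = t"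
      using insert.hyps False c by (auto simp: min_def intro!: Max_eqI simp: less_imp_le)
         (use Min_le[of T c] in fastforce)
    have "Min T \<le> c" using insert.hyps c by auto
    have "\<exists>\<gamma>. continuous_on {Min T..Max T} \<gamma> \<and> (\<forall>t\<in>T. \<gamma> t = g t) \<and>
        (\<forall>s\<in>T. \<forall>t\<in>T. s < t \<and> (\<forall>u\<in>T. \<not> (s < u \<and> u < t)) \<longrightarrow> Q s t \<gamma>)"
    proof (rule insert.IH[OF False])
      fix s t' assume "s \<in> T" "t' \<in> T" "s < t'" "\<And>u. u \<in> T \<Longrightarrow> \<not> (s < u \<and> u < t')"
      then show "\<exists>\<gamma>. continuous_on {s..t'} \<gamma> \<and> \<gamma> s = g s \<and> \<gamma> t' = g t' \<and> Q s t' \<gamma>"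
        using insert.hyps by (intro insert.prems(2)) force+
    qed
    then obtain \<gamma>1 where \<gamma>1: "continuous_on {Min T..c} \<gamma>1" "\<And>t. t \<in> T \<Longrightarrow> \<gamma>1 t = g t"
      "\<And>s t. s \<in> T \<Longrightarrow> t \<in> T \<Longrightarrow> s < t \<Longrightarrow> (\<forall>u\<in>T. \<not> (s < u \<and> u < t)) \<Longrightarrow> Q s t \<gamma>1"
      unfolding c_def by blast
    have "\<exists>\<gamma>. continuous_on {c..t} \<gamma> \<and> \<gamma> c = g c \<and> \<gamma> t = g t \<and> Q c t \<gamma>"
      using c by (intro insert.prems(2)) force+
    then obtain \<gamma>2 where \<gamma>2: "continuous_on {c..t} \<gamma>2" "\<gamma>2 c = g c" "\<gamma>2 t = g t" "Q c t \<gamma>2"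
      by blast
    define \<gamma> where "\<gamma> x = (if x \<le> c then \<gamma>1 x else \<gamma>2 x)" for x
    have "continuous_on ({Min T..c} \<union> {c..t}) \<gamma>"
      unfolding \<gamma>_def using \<gamma>1(1) \<gamma>2(1,2) \<gamma>1(2)[OF c(1)] by (intro continuous_on_If) auto
    moreover have "{Min T..c} \<union> {c..t} = {Min T..t}" using c \<open>Min T \<le> c\<close> by auto
    moreover have "\<gamma> u = g u" if "u \<in> insert t T" for u
      using that c \<gamma>1(2) \<gamma>2(3) by (auto simp: \<gamma>_def)
    moreover have "Q s u \<gamma>" if "s \<in> insert t T" "u \<in> insert t T" "s < u"
      "\<forall>v\<in>insert t T. \<not> (s < v \<and> v < u)" for s u
    proof (cases "u = t")
      case True
      then have "s = c" using that c by (metis insert_iff order_le_less less_irrefl)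
      then show ?thesis using True \<gamma>1(2)[OF c(1)] \<gamma>2(2) by (auto intro!: local[OF \<gamma>2(4)] simp: \<gamma>_def)
    next
      case ut: False
      then have "u \<in> T" "s \<in> T" using that insert.hyps by force+
      then show ?thesis using that c(3)[of u] by (intro local[OF \<gamma>1(3)]) (auto simp: \<gamma>_def)
    qed
    ultimately show ?thesis unfolding MinMax by (intro exI[of _ \<gamma>]) auto
  qed
qed simp

section \<open>Paths meeting each graph at most once\<close>

text \<open>A meeting inside a strip forces the curve to separate the heights at the two ends of the
  strip. Two meetings with one curve would therefore change sides in both directions, which taut
  heights forbid, or place both ends of the path on the curve.\<close>

lemma path_meeting_graphs_once:
  fixes A :: "'c set" and f :: "'c \<Rightarrow> real \<Rightarrow> real"
  assumes finA: "finite A" and ab: "a < b"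
    and cont: "\<And>C. C \<in> A \<Longrightarrow> continuous_on {l C..r C} (f C)"
    and cross_once: "\<And>C D i j k. \<lbrakk>C \<in> A; D \<in> A; C \<noteq> D; i < j; j < k;
        l C \<le> i; l D \<le> i; k \<le> r C; k \<le> r D\<rbrakk> \<Longrightarrow>
        \<not> (f C i \<le> f D i \<and> f D j \<le> f C j \<and> f C k \<le> f D k)"
    and no_common: "\<And>C. \<lbrakk>C \<in> A; l C \<le> a; b \<le> r C\<rbrakk> \<Longrightarrow> \<not> (f C a = ya \<and> f C b = yb)"
  shows "\<exists>\<gamma>. continuous_on {a..b} \<gamma> \<and> \<gamma> a = ya \<and> \<gamma> b = yb \<and>
    (\<forall>C\<in>A. \<forall>x\<in>{a..b} \<inter> {l C..r C}. \<forall>y\<in>{a..b} \<inter> {l C..r C}.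
      \<gamma> x = f C x \<and> \<gamma> y = f C y \<longrightarrow> x = y)"
proof -
  define M where "M C D = {x. C \<noteq> D \<and> l C \<le> x \<and> l D \<le> x \<and> x \<le> r C \<and> x \<le> r D \<and> f C x = f D x}" for C D
  define T where "T = {a, b} \<union> (l ` A \<union> r ` A \<union> (\<Union>C\<in>A. \<Union>D\<in>A. M C D)) \<inter> {a..b}"
  have "finite (M C D)" if CD: "C \<in> A" "D \<in> A" for C D
  proof -
    \<comment> \<open>Equality at \<open>x\<close> and \<open>y\<close> satisfies the weak outer
      inequalities of \<open>cross_once\<close> for either order of \<open>C\<close> and
      \<open>D\<close>; the order at the midpoint decides which instance is contradictory.\<close>
    have "\<not> x < y" if "x \<in> M C D" "y \<in> M C D" for x y
    proof
      assume "x < y"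
      define m where "m = (x + y) / 2"
      then have m: "x < m" "m < y" using \<open>x < y\<close> by auto
      show False
        using that CD m cross_once[of C D x m y] cross_once[of D C x m y]
        by (cases "f C m \<le> f D m") (auto simp: M_def)
    qed
    then have "x = y" if "x \<in> M C D" "y \<in> M C D" for x y
      using that by (meson linorder_neqE)
    then have "M C D = {} \<or> (\<exists>x. M C D = {x})" by blast
    then show ?thesis by auto
  qed
  then have finT: "finite T" using finA by (auto simp: T_def)
  have Tab: "a \<in> T" "b \<in> T" "\<And>t. t \<in> T \<Longrightarrow> a \<le> t \<and> t \<le> b" using ab by (auto simp: T_def)
  have events: "\<And>C. \<lbrakk>C \<in> A; a \<le> l C; l C \<le> b\<rbrakk> \<Longrightarrow> l C \<in> T" "\<And>C. \<lbrakk>C \<in> A; a \<le> r C; r C \<le> b\<rbrakk> \<Longrightarrow> r C \<in> T"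
    "\<And>C D x. \<lbrakk>C \<in> A; D \<in> A; x \<in> M C D; a \<le> x; x \<le> b\<rbrakk> \<Longrightarrow> x \<in> T"
    by (auto simp: T_def)
  interpret graph_heights A l r f T a ya b yb
    by unfold_locales (use finA finT Tab ab cross_once no_common in auto)
  obtain g where g: "heights g" "\<not> up_down g" "\<not> down_up g" using taut_heights_exist by blast
  \<comment> \<open>This is the conclusion of \<open>strip_path\<close> for the curves spanning the
    strip. A curve with an end in \<open>{a..b}\<close> has that end in \<open>T\<close>, so it
    spans every strip whose interior it enters.\<close>
  define Q where "Q s t \<gamma> \<longleftrightarrow> (\<forall>C\<in>A. l C \<le> s \<and> t \<le> r C \<longrightarrow>
      (\<forall>x. s < x \<and> x < t \<and> \<gamma> x = f C x \<longrightarrow> (g s - f C s) * (g t - f C t) < 0) \<and>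
      (\<forall>x y. s < x \<and> x < t \<and> s < y \<and> y < t \<and> \<gamma> x = f C x \<and> \<gamma> y = f C y \<longrightarrow> x = y))" for s t \<gamma>
  have strip: "\<exists>\<gamma>. continuous_on {s..t} \<gamma> \<and> \<gamma> s = g s \<and> \<gamma> t = g t \<and> Q s t \<gamma>"
    if st: "s \<in> T" "t \<in> T" "s < t" and consec: "\<And>u. u \<in> T \<Longrightarrow> \<not> (s < u \<and> u < t)" for s t
  proof -
    let ?F = "{C \<in> A. l C \<le> s \<and> t \<le> r C}"
    have st_ab: "a \<le> s" "t \<le> b" using st Tab by auto
    have "\<exists>\<gamma>. continuous_on {s..t} \<gamma> \<and> \<gamma> s = g s \<and> \<gamma> t = g t \<and>
      (\<forall>C\<in>?F. (\<forall>x. s < x \<and> x < t \<and> \<gamma> x = f C x \<longrightarrow> (g s - f C s) * (g t - f C t) < 0) \<and>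
        (\<forall>x y. s < x \<and> x < t \<and> s < y \<and> y < t \<and> \<gamma> x = f C x \<and> \<gamma> y = f C y \<longrightarrow> x = y))"
    proof (rule strip_path)
      show "continuous_on {s..t} (f C)" if "C \<in> ?F" for C
        using cont[of C] that by (auto elim: continuous_on_subset)
      show "f C x \<noteq> f D x" if "C \<in> ?F" "D \<in> ?F" "C \<noteq> D" "s < x" "x < t" for C D x
      proof
        assume "f C x = f D x"
        then have "x \<in> M C D" using that by (auto simp: M_def)
        then have "x \<in> T" using that st_ab events(3)[of C D x] by simp
        then show False using consec that by blast
      qed
      show "\<not> (f C s = g s \<and> f C t = g t)" if "C \<in> ?F" for C
      proof
        assume eq: "f C s = g s \<and> f C t = g t"
        have "s = a" "t = b" using g(1) that eq st st_ab by (force simp: heights_def)+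
        then show False using no_common[of C] that eq g(1) by (auto simp: heights_def)
      qed
    qed (use finA st in auto)
    then show ?thesis unfolding Q_def by auto
  qed
  have Q_local: "Q s t \<delta>" if "Q s t \<gamma>" "\<And>x. s \<le> x \<Longrightarrow> x \<le> t \<Longrightarrow> \<gamma> x = \<delta> x" for s t \<gamma> \<delta>
    using that unfolding Q_def by (metis less_imp_le)
  have "\<exists>\<gamma>. continuous_on {Min T..Max T} \<gamma> \<and> (\<forall>t\<in>T. \<gamma> t = g t) \<and>
      (\<forall>s\<in>T. \<forall>t\<in>T. s < t \<and> (\<forall>u\<in>T. \<not> (s < u \<and> u < t)) \<longrightarrow> Q s t \<gamma>)"
    by (rule glue_strips[where Q = Q, OF finT _ _ strip]) (use Q_local Tab in auto)
  moreover have "Min T = a" "Max T = b" using finT Tab by (auto intro!: Min_eqI Max_eqI)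
  ultimately obtain \<gamma> where \<gamma>: "continuous_on {a..b} \<gamma>" "\<And>t. t \<in> T \<Longrightarrow> \<gamma> t = g t"
      and QT: "\<And>s t. \<lbrakk>s \<in> T; t \<in> T; s < t; \<forall>u\<in>T. \<not> (s < u \<and> u < t)\<rbrakk> \<Longrightarrow> Q s t \<gamma>"
    by auto
  define consec where "consec s t \<longleftrightarrow> s \<in> T \<and> t \<in> T \<and> s < t \<and> (\<forall>u\<in>T. \<not> (s < u \<and> u < t))" for s t
  \<comment> \<open>At abscissas of \<open>T\<close> other than \<open>a\<close> and
    \<open>b\<close> the heights avoid all curves, so a meeting is at an end of the path or strictly
    inside a strip.\<close>
  have meet: "x = a \<and> g a = f C a \<or> x = b \<and> g b = f C b \<or>
      (\<exists>s t. consec s t \<and> s < x \<and> x < t \<and> l C \<le> s \<and> t \<le> r C \<and> (g s - f C s) * (g t - f C t) < 0)"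
    if C: "C \<in> A" and x: "a \<le> x" "x \<le> b" "l C \<le> x" "x \<le> r C" "\<gamma> x = f C x" for C x
  proof (cases "x \<in> T")
    case True
    then have "x = a \<or> x = b" using g(1) C x \<gamma>(2)[of x] by (force simp: heights_def)
    then show ?thesis using True x \<gamma>(2)[of x] by auto
  next
    case False
    define s where "s = Max {u \<in> T. u < x}"
    define t where "t = Min {u \<in> T. x < u}"
    have ne: "{u \<in> T. u < x} \<noteq> {}" "{u \<in> T. x < u} \<noteq> {}"
      using False x Tab by (force simp: order_less_le)+
    have st: "s \<in> T" "s < x" "t \<in> T" "x < t"
      using Max_in[OF _ ne(1)] Min_in[OF _ ne(2)] finT by (auto simp: s_def t_def)
    have "u \<le> s \<or> t \<le> u" if "u \<in> T" for u
    proof (cases "u < x")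
      case True
      then have "u \<le> s" unfolding s_def using that finT by (intro Max_ge) auto
      then show ?thesis ..
    next
      case F: False
      then have "t \<le> u" unfolding t_def using that False finT by (intro Min_le) (auto simp: order_less_le)
      then show ?thesis ..
    qed
    then have con: "consec s t" using st unfolding consec_def by fastforce
    have "l C \<le> s"
    proof (rule ccontr)
      assume "\<not> l C \<le> s"
      moreover from this have "l C \<in> T" using events(1)[OF C] st Tab(3)[of s] x(1-4) by linarith
      ultimately show False using con x(3,4) st unfolding consec_def by force
    qed
    moreover have "t \<le> r C"
    proof (rule ccontr)
      assume "\<not> t \<le> r C"
      moreover from this have "r C \<in> T" using events(2)[OF C] st Tab(3)[of t] x(1-4) by linarith
      ultimately show False using con x(3,4) st unfolding consec_def by force
    qed
    moreover have "Q s t \<gamma>" using QT con by (auto simp: consec_def)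
    ultimately have "(g s - f C s) * (g t - f C t) < 0" using C x st unfolding Q_def by blast
    then show ?thesis using con st \<open>l C \<le> s\<close> \<open>t \<le> r C\<close> by blast
  qed
  have alt: "\<not> (g i \<le> f C i \<and> f C j < g j \<and> g k \<le> f C k)" "\<not> (f C i \<le> g i \<and> g j < f C j \<and> f C k \<le> g k)"
    if "C \<in> A" "i \<in> T" "j \<in> T" "k \<in> T" "i < j" "j < k" "l C \<le> i" "k \<le> r C" for C i j k
    using that g(2,3) unfolding up_down_def down_up_def by blast+
  have no_two: False if C: "C \<in> A" and xy: "x < y"
    and x: "a \<le> x" "x \<le> b" "l C \<le> x" "x \<le> r C" "\<gamma> x = f C x"
    and y: "a \<le> y" "y \<le> b" "l C \<le> y" "y \<le> r C" "\<gamma> y = f C y" for C x y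
  proof -
    consider (ab) "x = a" "y = b" "g a = f C a" "g b = f C b"
      | (left) s t where "x = a" "g a = f C a" "consec s t" "s < y" "l C \<le> s" "t \<le> r C"
          "(g s - f C s) * (g t - f C t) < 0"
      | (right) s t where "y = b" "g b = f C b" "consec s t" "x < t" "l C \<le> s" "t \<le> r C"
          "(g s - f C s) * (g t - f C t) < 0"
      | (inner) s t s' t' where "consec s t" "s < x" "x < t" "l C \<le> s" "t \<le> r C"
          "(g s - f C s) * (g t - f C t) < 0" "consec s' t'" "s' < y" "y < t'" "l C \<le> s'" "t' \<le> r C"
          "(g s' - f C s') * (g t' - f C t') < 0"
      using meet[OF C x] meet[OF C y] xy x y by (metis less_le_not_le)
    then show False
    proof cases
      case ab
      then show False using no_common[of C] g(1) C x y by (auto simp: heights_def)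
    next
      case left
      \<comment> \<open>If the strip began at \<open>a\<close>, which lies on \<open>C\<close>, the
        product would be zero. Hence \<open>a\<close>, \<open>s\<close>, \<open>t\<close> are
        distinct, and since the outer inequality holds both ways at \<open>a\<close>, they form a
        forbidden pattern.\<close>
      then have "a < s" using Tab(3)[of s] by (cases "a = s") (auto simp: consec_def)
      then show False
        using left alt[of C a s t] C Tab x by (auto simp: consec_def mult_less_0_iff)
    next
      case right
      then have "t < b" using Tab(3)[of t] by (cases "b = t") (auto simp: consec_def)
      then show False
        using right alt[of C s t b] C Tab y by (auto simp: consec_def mult_less_0_iff)
    next
      case inner
      show False
      proof (cases "s = s'")
        case True
        then have "\<not> t < t'" "\<not> t' < t" using inner(1,7) unfolding consec_def by blast+
        then have "t = t'" by simp
        moreover have "Q s t \<gamma>" using QT inner(1) by (auto simp: consec_def)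
        ultimately have "x = y" using inner True C x y unfolding Q_def by blast
        then show False using xy by simp
      next
        case False
        have st: "s \<in> T" "t \<in> T" "s' \<in> T" "t' \<in> T" "s < t" "s' < t'"
            "\<not> (s < s' \<and> s' < t)" "\<not> (s' < s \<and> s < t')"
          using inner(1,7) unfolding consec_def by auto
        then have "t \<le> s'" using False inner(2,3,8,9) xy by linarith
        then have "t < t'" "s' \<le> r C" using st inner(11) by auto
        show False
        \<comment> \<open>The path changes sides of \<open>C\<close> between \<open>s\<close> and
          \<open>t\<close> and again between \<open>s'\<close> and \<open>t'\<close>. For adjacent
          strips \<open>s\<close>, \<open>t\<close>, \<open>t'\<close> alternate; otherwise one of
          \<open>s'\<close> and \<open>t'\<close> has the side of \<open>s\<close> and completes the
          alternation begun by \<open>s\<close> and \<open>t\<close>.\<close>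
        proof (cases "t = s'")
          case True
          then show False
            using alt[OF C st(1,2,4,5) \<open>t < t'\<close> inner(4,11)] inner(6,12) by (auto simp: mult_less_0_iff)
        next
          case False
          then have "t < s'" using \<open>t \<le> s'\<close> by simp
          then show False
            using alt[OF C st(1,2,4,5) \<open>t < t'\<close> inner(4,11)]
              alt[OF C st(1,2,3,5) _ inner(4) \<open>s' \<le> r C\<close>] inner(6,12)
            by (auto simp: mult_less_0_iff)
        qed
      qed
    qed
  qed
  have "x = y" if "C \<in> A" "x \<in> {a..b} \<inter> {l C..r C}" "y \<in> {a..b} \<inter> {l C..r C}"
    "\<gamma> x = f C x" "\<gamma> y = f C y" for C x y
    using no_two[of C x y] no_two[of C y x] that by (cases x y rule: linorder_cases) auto
  moreover have "\<gamma> a = ya" "\<gamma> b = yb" using \<gamma>(2) Tab g(1) by (auto simp: heights_def)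
  ultimately show ?thesis using \<gamma>(1) by blast
qed

section \<open>Extendability of arrangements\<close>

text \<open>The case of \<open>a\<close> to the left of \<open>b\<close>, obtained by replacing the
  curves with their graph functions; the other case follows by exchanging the ends, since
  \<open>has_endpoints\<close> is symmetric.\<close>

lemma extendable_left_to_right:
  assumes arr: "pseudosegment_arrangement \<A>" and mono: "\<forall>C \<in> \<A>. x_monotone C"
    and ab: "fst a < fst b" and nc: "\<not> (\<exists>C \<in> \<A>. a \<in> C \<and> b \<in> C)"
  shows "\<exists>\<gamma>. x_monotone \<gamma> \<and> has_endpoints \<gamma> a b \<and> (\<forall>C \<in> \<A>. meets_at_most_once \<gamma> C)"
proof -
  have "\<forall>C\<in>\<A>. \<exists>l r f. continuous_on {l..r} f \<and> C = (\<lambda>x. (x, f x)) ` {l..r}"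
    using arr mono x_monotone_curve_is_graph by (auto simp: pseudosegment_arrangement_def)
  then obtain l r f where cont: "\<And>C. C \<in> \<A> \<Longrightarrow> continuous_on {l C..r C} (f C)"
    and graph: "\<And>C. C \<in> \<A> \<Longrightarrow> C = (\<lambda>x. (x, f C x)) ` {l C..r C}"
    by metis
  have "\<exists>\<gamma>. continuous_on {fst a..fst b} \<gamma> \<and> \<gamma> (fst a) = snd a \<and> \<gamma> (fst b) = snd b \<and>
    (\<forall>C\<in>\<A>. \<forall>x\<in>{fst a..fst b} \<inter> {l C..r C}. \<forall>y\<in>{fst a..fst b} \<inter> {l C..r C}.
      \<gamma> x = f C x \<and> \<gamma> y = f C y \<longrightarrow> x = y)"
  proof (rule path_meeting_graphs_once)
    show "finite \<A>" using arr by (simp add: pseudosegment_arrangement_def)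
    show "\<not> (f C i \<le> f D i \<and> f D j \<le> f C j \<and> f C k \<le> f D k)"
      if "C \<in> \<A>" "D \<in> \<A>" "C \<noteq> D" "i < j" "j < k" "l C \<le> i" "l D \<le> i" "k \<le> r C" "k \<le> r D" for C D i j k
      using graphs_cross_once[OF graph[OF that(1)] graph[OF that(2)] cont[OF that(1)] cont[OF that(2)] _ _ that(4-9)]
        arr that(1-3) unfolding pseudosegment_arrangement_def by blast
    show "\<not> (f C (fst a) = snd a \<and> f C (fst b) = snd b)"
      if "C \<in> \<A>" "l C \<le> fst a" "fst b \<le> r C" for C
    proof
      assume "f C (fst a) = snd a \<and> f C (fst b) = snd b"
      then have "a = (fst a, f C (fst a))" "b = (fst b, f C (fst b))" by (auto simp: prod_eq_iff)
      then have "a \<in> C" "b \<in> C" using graph[OF that(1)] that ab by (metis atLeastAtMost_iff imageI less_imp_le order_trans)+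
      then show False using nc that(1) by blast
    qed
  qed (use ab cont in auto)
  then obtain \<gamma> where \<gamma>: "continuous_on {fst a..fst b} \<gamma>" "\<gamma> (fst a) = snd a" "\<gamma> (fst b) = snd b"
    and once: "\<And>C x y. \<lbrakk>C \<in> \<A>; x \<in> {fst a..fst b} \<inter> {l C..r C}; y \<in> {fst a..fst b} \<inter> {l C..r C};
      \<gamma> x = f C x; \<gamma> y = f C y\<rbrakk> \<Longrightarrow> x = y"
    by blast
  let ?G = "(\<lambda>x. (x, \<gamma> x)) ` {fst a..fst b}"
  have "x_monotone ?G" by (auto simp: x_monotone_def meets_at_most_once_def)
  moreover have "has_endpoints ?G a b"
    using has_endpoints_graph[OF ab \<gamma>(1)] \<gamma>(2,3) by simp
  moreover have "meets_at_most_once ?G C" if "C \<in> \<A>" for C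
    unfolding meets_at_most_once_def
  proof (intro ballI)
    fix p q assume pq: "p \<in> ?G \<inter> C" "q \<in> ?G \<inter> C"
    have on: "fst z \<in> {fst a..fst b} \<inter> {l C..r C} \<and> \<gamma> (fst z) = f C (fst z) \<and> z = (fst z, \<gamma> (fst z))"
      if "z \<in> ?G \<inter> C" for z
    proof -
      have "z \<in> (\<lambda>x. (x, f C x)) ` {l C..r C}" using that graph[OF \<open>C \<in> \<A>\<close>] by blast
      then show ?thesis using that by auto
    qed
    then have "fst p = fst q" using once[OF that] pq by blast
    then show "p = q" using on pq by metis
  qed
  ultimately show ?thesis by blast
qed

theorem theorem1:
  fixes \<A> :: "plane set set" and a b :: plane
  assumes "pseudosegment_arrangement \<A>"
    and "\<forall>C \<in> \<A>. x_monotone C"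
    and "fst a \<noteq> fst b"
    and "\<not> (\<exists>C \<in> \<A>. a \<in> C \<and> b \<in> C)"
  shows "\<exists>\<gamma>. simple_curve \<gamma> \<and> x_monotone \<gamma> \<and> has_endpoints \<gamma> a b \<and>
           (\<forall>C \<in> \<A>. meets_at_most_once \<gamma> C)"
proof (cases "fst a < fst b")
  case True
  then show ?thesis
    using extendable_left_to_right[OF assms(1,2)] assms(4) simple_curve_if_has_endpoints by blast
next
  case False
  then have "fst b < fst a" using assms(3) by simp
  moreover have "\<not> (\<exists>C \<in> \<A>. b \<in> C \<and> a \<in> C)" using assms(4) by blast
  ultimately obtain \<gamma> where \<gamma>: "x_monotone \<gamma>" "has_endpoints \<gamma> b a" "\<forall>C \<in> \<A>. meets_at_most_once \<gamma> C"
    using extendable_left_to_right[OF assms(1,2)] by blast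
  then show ?thesis using has_endpoints_sym[OF \<gamma>(2)] simple_curve_if_has_endpoints by blast
qed

end
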